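(* Let $\mathcal{P}$ be a finite index set and $\{A_p : p\in\mathcal{P}\}$ a collection of real $n\times n$ matrices, each of which is either stable or unstable. Let $\tau,\eta>0$ and let $\sigma\in\mathcal{S}[\tau,\eta]$ be a switching signal with switching times $\{t_k\}_{k\ge1}$. Then there exists a nonempty collection $\mathcal{I}=\{I_q : q\in\mathcal{Q}\}$ of nonzero real $n\times n$ matrices such that for every function $\omega:\{t_1,t_2,\dots\}\to\mathcal{Q}$ the impulsive switched system $\dot x(t)=A_{\sigma(t)}x(t)$, $x(t_k)=I_{\omega(t_k)}\,x(t_k^-)$ ($k\ge1$) is stable.
   Context: A real matrix is called stable if all its eigenvalues have negative real part, and unstable if at least one eigenvalue has positive real part. A switching signal is a right-continuous piecewise constant function $\sigma:[0,\infty)\to\mathcal{P}$ whose set of discontinuities $\{t_k\}_{k\ge1}$ (switching times) is an increasing sequence with $t_k\uparrow\infty$; put $t_0=0$. $\mathcal{S}[\tau,\eta]$ is the set of switching signals such that for all $k\ge1$: $t_k-t_{k-1}\ge\tau$ if $A_{\sigma(t_{k-1})}$ is stable, and $t_k-t_{k-1}\le\eta$ if $A_{\sigma(t_{k-1})}$ is unstable. In the impulsive switched system, $\dot x=A_{\sigma(t)}x$ holds on each $[t_{k-1},t_k)$ and $x(t_k^-)=\lim_{t\to t_k^-}x(t)$. The system (for fixed $\sigma,\omega$) is stable if for every $\epsilon>0$ there is $\delta>0$ such that $\|x(0)\|<\delta$ implies $\|x(t)\|<\epsilon$ for all $t>0$ (Euclidean norm). *)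

theory Defs
  imports "HOL-Analysis.Analysis"
begin

definition complexify :: "real^'n^'m \<Rightarrow> complex^'n^'m" where
  "complexify A = (\<chi> i j. complex_of_real (A $ i $ j))"

definition complex_eigenvalue :: "real^'n^'n \<Rightarrow> complex \<Rightarrow> bool" where
  "complex_eigenvalue A \<mu> \<longleftrightarrow> (\<exists>v. v \<noteq> 0 \<and> complexify A *v v = \<mu> *s v)"

definition stable_matrix :: "real^'n^'n \<Rightarrow> bool" where
  "stable_matrix A \<longleftrightarrow> (\<forall>\<mu>. complex_eigenvalue A \<mu> \<longrightarrow> Re \<mu> < 0)"

definition unstable_matrix :: "real^'n^'n \<Rightarrow> bool" where
  "unstable_matrix A \<longleftrightarrow> (\<exists>\<mu>. complex_eigenvalue A \<mu> \<and> Re \<mu> > 0)"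

text \<open>Signals are functions on the half-line of nonnegative times; their values at negative
  arguments play no role. The index set is discrete, so continuity at a point means being
  constant near it.\<close>

definition discontinuities :: "(real \<Rightarrow> 'p) \<Rightarrow> real set" where
  "discontinuities \<sigma> = {s. 0 \<le> s \<and> \<not> (\<forall>\<^sub>F u in at s within {0..}. \<sigma> u = \<sigma> s)}"

definition right_continuous_signal :: "(real \<Rightarrow> 'p) \<Rightarrow> bool" where
  "right_continuous_signal \<sigma> \<longleftrightarrow> (\<forall>s\<ge>0. \<forall>\<^sub>F u in at_right s. \<sigma> u = \<sigma> s)"

text \<open>The value \<open>t 0 = 0\<close> is a convention; the switching times proper are \<open>t k\<close> for \<open>k \<ge> 1\<close>.\<close>

definition switching_times :: "(real \<Rightarrow> 'p) \<Rightarrow> (nat \<Rightarrow> real) \<Rightarrow> bool" where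
  "switching_times \<sigma> t \<longleftrightarrow>
     t 0 = 0 \<and> strict_mono t \<and> filterlim t at_top sequentially \<and>
     discontinuities \<sigma> = t ` {1..}"

definition switching_signal :: "'p set \<Rightarrow> (real \<Rightarrow> 'p) \<Rightarrow> bool" where
  "switching_signal P \<sigma> \<longleftrightarrow>
     \<sigma> \<in> {0..} \<rightarrow> P \<and> right_continuous_signal \<sigma> \<and>
     (\<exists>t. switching_times \<sigma> t \<and> (\<forall>k. \<sigma> constant_on {t k<..<t (Suc k)}))"

text \<open>A signal has at most one sequence of switching times, so the quantifier over \<open>t\<close> below
  ranges over exactly one sequence.\<close>

definition dwell_flee_signals ::
    "'p set \<Rightarrow> ('p \<Rightarrow> real^'n^'n) \<Rightarrow> real \<Rightarrow> real \<Rightarrow> (real \<Rightarrow> 'p) set" where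
  "dwell_flee_signals P A \<tau> \<eta> =
     {\<sigma>. switching_signal P \<sigma> \<and>
         (\<forall>t. switching_times \<sigma> t \<longrightarrow>
           (\<forall>k\<ge>1. (stable_matrix (A (\<sigma> (t (k - 1)))) \<longrightarrow> t k - t (k - 1) \<ge> \<tau>) \<and>
                  (unstable_matrix (A (\<sigma> (t (k - 1)))) \<longrightarrow> t k - t (k - 1) \<le> \<eta>)))}"

text \<open>At the left endpoint of each interval the derivative is the right-hand one.\<close>

definition impulsive_solution ::
    "('p \<Rightarrow> real^'n^'n) \<Rightarrow> (real \<Rightarrow> 'p) \<Rightarrow> (nat \<Rightarrow> real) \<Rightarrow> ('q \<Rightarrow> real^'n^'n) \<Rightarrow> (real \<Rightarrow> 'q)
      \<Rightarrow> (real \<Rightarrow> real^'n) \<Rightarrow> bool" where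
  "impulsive_solution A \<sigma> t I \<omega> x \<longleftrightarrow>
     (\<forall>k\<ge>1. (\<forall>s\<in>{t (k - 1)..<t k}.
               (x has_vector_derivative A (\<sigma> s) *v x s) (at s within {t (k - 1)..<t k})) \<and>
            (\<exists>y. (x \<longlongrightarrow> y) (at_left (t k)) \<and> x (t k) = I (\<omega> (t k)) *v y))"

definition impulsive_stable ::
    "('p \<Rightarrow> real^'n^'n) \<Rightarrow> (real \<Rightarrow> 'p) \<Rightarrow> (nat \<Rightarrow> real) \<Rightarrow> ('q \<Rightarrow> real^'n^'n) \<Rightarrow> (real \<Rightarrow> 'q)
      \<Rightarrow> bool" where
  "impulsive_stable A \<sigma> t I \<omega> \<longleftrightarrow>
     (\<forall>\<epsilon>>0. \<exists>\<delta>>0. \<forall>x. impulsive_solution A \<sigma> t I \<omega> x \<longrightarrow> norm (x 0) < \<delta> \<longrightarrow>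
        (\<forall>s>0. norm (x s) < \<epsilon>))"

text \<open>A family of impulse matrices is given by an index set \<open>Q\<close> and a map \<open>I\<close> on it. HOL does
  not allow quantifying over the type of indices; when the existence of such a family is
  asserted, taking the indices themselves from the type of matrices loses no generality, since
  every family can be re-indexed by its set of members.\<close>

end

theory Submission
  imports Defs "HOL-Computational_Algebra.Fundamental_Theorem_Algebra"
begin

text \<open>The single impulse matrix \<open>(1 / M) I\<close> suffices once the flow of every subsystem amplifies
  norms by at most a common factor \<open>M\<close> over every admissible interval: then the state does not
  grow from one switching time to the next, and in between it exceeds its initial norm at most by
  the factor \<open>M\<close>. Intervals of instability have length at most \<open>\<eta>\<close>, so what matters is that the
  flow of a stable matrix \<open>B\<close> is bounded for all times. For this, let
  \<open>(B - l\<^sub>1) \<dots> (B - l\<^sub>m) = 0\<close> with eigenvalues \<open>l\<^sub>i\<close>. If \<open>y' = B y\<close>, then \<open>g = (B - l\<^sub>1) y\<close> again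
  solves \<open>g' = B g\<close> and is annihilated by the shorter product, hence bounded by induction, and
  variation of constants in \<open>y' = l\<^sub>1 y + g\<close> bounds \<open>y\<close>.\<close>

section \<open>Annihilating products of linear factors in a matrix\<close>

text \<open>The factor of the head of the list acts first. The recursion therefore matches the
  passage from a solution \<open>y\<close> to \<open>B *v y - l *s y\<close>, which is annihilated
  by the product over the tail.\<close>

primrec shifted_prod :: "complex^'n^'n \<Rightarrow> complex list \<Rightarrow> complex^'n \<Rightarrow> complex^'n" where
  "shifted_prod B [] v = v"
| "shifted_prod B (l # ls) v = shifted_prod B ls (B *v v - l *s v)"

text \<open>All factors are polynomials in \<open>B\<close>, so the factor applied first may equally
  be applied last, where it can be cancelled if it is injective.\<close>

lemma shifted_prod_commute:
  "shifted_prod B ls (B *v v - l *s v) = B *v shifted_prod B ls v - l *s shifted_prod B ls v"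
proof (induction ls arbitrary: v)
  case (Cons m ls)
  have "B *v (B *v v - l *s v) - m *s (B *v v - l *s v)
      = B *v (B *v v - m *s v) - l *s (B *v v - m *s v)"
    by (simp add: matrix_vector_mult_diff_distrib vector_scalar_commute[symmetric]
        vector_sub_rdistrib vec_eq_iff algebra_simps)
  then show ?case using Cons[of "B *v v - m *s v"] by simp
qed simp

text \<open>For \<open>l\<close> not an eigenvalue, \<open>B - l\<close> is injective and can be cancelled.\<close>

lemma shifted_prod_filter:
  assumes "\<And>v. shifted_prod B ls v = 0"
  shows "shifted_prod B (filter (\<lambda>l. \<exists>v. v \<noteq> 0 \<and> B *v v = l *s v) ls) v = 0"
proof -
  have "shifted_prod B ls v = 0 \<Longrightarrow>
    shifted_prod B (filter (\<lambda>l. \<exists>v. v \<noteq> 0 \<and> B *v v = l *s v) ls) v = 0" for v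
  proof (induction ls arbitrary: v)
    case (Cons l ls)
    let ?w = "shifted_prod B (filter (\<lambda>l. \<exists>v. v \<noteq> 0 \<and> B *v v = l *s v) ls) v"
    have IH: "shifted_prod B (filter (\<lambda>l. \<exists>v. v \<noteq> 0 \<and> B *v v = l *s v) ls) (B *v v - l *s v) = 0"
      using Cons by simp
    show ?case
    proof (cases "\<exists>v. v \<noteq> 0 \<and> B *v v = l *s v")
      case True
      then show ?thesis using IH by simp
    next
      case False
      then have "?w = 0" using IH unfolding shifted_prod_commute by auto
      with False show ?thesis by (simp only: filter.simps if_False)
    qed
  qed simp
  then show ?thesis using assms by blast
qed

text \<open>Links the factored form of a polynomial in \<open>B\<close> with a linear combination of
  powers of \<open>B\<close>. The bound \<open>N\<close> may exceed the degree because the surplus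
  coefficients vanish.\<close>

lemma shifted_prod_eq_sum:
  assumes "length ls \<le> N"
  shows "shifted_prod B ls v =
    (\<Sum>i\<le>N. coeff (\<Prod>l\<leftarrow>ls. [:-l, 1:]) i *s (((*v) B) ^^ i) v)"
  using assms
proof (induction ls arbitrary: v N)
  case Nil
  have "(\<Sum>i\<le>N. coeff (1 :: complex poly) i *s (((*v) B) ^^ i) v)
      = (\<Sum>i\<le>N. if i = 0 then v else 0)"
    by (intro sum.cong) (auto simp: one_pCons coeff_pCons split: nat.split)
  then show ?case by (simp add: sum.delta)
next
  case (Cons l ls)
  obtain M where M: "N = Suc M" "length ls \<le> M" using Cons.prems by (cases N) auto
  define q where "q = (\<Prod>l\<leftarrow>ls. [:-l, 1:])"
  have deg: "degree q \<le> length ls"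
    unfolding q_def by (rule order.trans[OF degree_prod_list_le]) (simp add: o_def sum_list_triv)
  \<comment> \<open>This zero coefficient later extends the sum with factor \<open>l\<close> from
    \<open>M\<close> to \<open>N\<close>, the range of the shifted sum.\<close>
  have c0: "coeff q N = 0" using deg M by (intro coeff_eq_0) simp
  let ?e = "\<lambda>i. (((*v) B) ^^ i) v"
  have lin: "(((*v) B) ^^ i) (B *v v - l *s v) = ?e (Suc i) - l *s ?e i" for i
    by (induction i) (simp_all add: matrix_vector_mult_diff_distrib vector_scalar_commute)
  have "shifted_prod B (l # ls) v = (\<Sum>i\<le>M. coeff q i *s (?e (Suc i) - l *s ?e i))"
    using Cons.IH[OF M(2), of "B *v v - l *s v"] unfolding lin q_def by simp
  also have "\<dots> = (\<Sum>i\<le>M. coeff q i *s ?e (Suc i)) - (\<Sum>i\<le>M. (l * coeff q i) *s ?e i)"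
    by (simp add: sum_subtractf[symmetric] vec_eq_iff algebra_simps)
  also have "(\<Sum>i\<le>M. coeff q i *s ?e (Suc i)) = (\<Sum>i\<le>N. coeff (pCons 0 q) i *s ?e i)"
    unfolding M(1) sum.atMost_Suc_shift by simp
  also have "(\<Sum>i\<le>M. (l * coeff q i) *s ?e i) = (\<Sum>i\<le>N. (l * coeff q i) *s ?e i)"
    using c0 unfolding M(1) by simp
  also have "(\<Sum>i\<le>N. coeff (pCons 0 q) i *s ?e i) - (\<Sum>i\<le>N. (l * coeff q i) *s ?e i)
      = (\<Sum>i\<le>N. coeff ([:-l, 1:] * q) i *s ?e i)"
    by (simp add: sum_subtractf[symmetric] vec_eq_iff algebra_simps)
  finally show ?case unfolding q_def by simp
qed

text \<open>More vectors than the dimension are dependent. Speaking of a sequence instead of a set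
  also covers repetitions: if \<open>g i = g j\<close>, the relation is the difference of these two
  terms.\<close>

lemma dependent_sequence:
  fixes g :: "nat \<Rightarrow> 'a::euclidean_space"
  obtains r N where "\<exists>i\<le>N. r i \<noteq> 0" "(\<Sum>i\<le>N. r i *\<^sub>R g i) = 0"
proof (cases "inj_on g {..DIM('a)}")
  case True
  have "dependent (g ` {..DIM('a)})"
    by (rule dependent_biggerset) (simp add: card_image True)
  then obtain u where u: "\<exists>v\<in>g ` {..DIM('a)}. u v \<noteq> 0"
    "(\<Sum>v\<in>g ` {..DIM('a)}. u v *\<^sub>R v) = 0"
    using dependent_finite[of "g ` {..DIM('a)}"] by auto
  show ?thesis
    using u that[of "DIM('a)" "\<lambda>i. u (g i)"] by (auto simp: sum.reindex[OF True])
next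
  case False
  then obtain i j where ij: "i \<le> DIM('a)" "j \<le> DIM('a)" "g i = g j" "i \<noteq> j"
    by (auto simp: inj_on_def)
  let ?r = "\<lambda>k. (if k = i then 1 else 0) - (if k = j then 1 else 0) :: real"
  have "(\<Sum>k\<le>DIM('a). ?r k *\<^sub>R g k) =
     (\<Sum>k\<le>DIM('a). (if k = i then g k else 0) - (if k = j then g k else 0))"
    by (intro sum.cong) auto
  also have "\<dots> = 0" unfolding sum_subtractf using ij by simp
  finally show ?thesis using ij that[of "DIM('a)" ?r] by force
qed

text \<open>By finite dimension some nonzero polynomial \<open>p\<close> annihilates
  \<open>B\<close>, and over the complex numbers \<open>p\<close> splits into linear
  factors.\<close>

lemma annihilating_shifted_prod:
  "\<exists>ls. \<forall>v. shifted_prod B ls v = 0"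
proof -
  define g where "g i = (((**) B) ^^ i) (mat 1)" for i
  have g: "g i *v v = (((*v) B) ^^ i) v" for i v
    by (induction i) (simp_all add: g_def matrix_vector_mul_assoc[symmetric])
  \<comment> \<open>Complex matrices form a Euclidean space over the reals, so the powers of
    \<open>B\<close> satisfy a relation with real coefficients.\<close>
  obtain r N where r: "\<exists>i\<le>N. r i \<noteq> 0" and sum0: "(\<Sum>i\<le>N. r i *\<^sub>R g i) = 0"
    using dependent_sequence .
  define p where "p = (\<Sum>i\<le>N. monom (complex_of_real (r i)) i)"
  have coeff: "coeff p i = (if i \<le> N then of_real (r i) else 0)" for i
    by (simp add: p_def coeff_sum)
  have p0: "p \<noteq> 0" using r coeff by (metis coeff_0 of_real_eq_0_iff)
  obtain S where S: "size S = degree p" "p = smult (lead_coeff p) (\<Prod>x\<in>#S. [:-x, 1:])"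
    using alg_closed_imp_factorization[OF p0] by blast
  obtain ls where ls: "mset ls = S" using ex_mset by blast
  have len: "length ls \<le> N"
    using S(1) ls coeff by (metis degree_le not_less size_mset)
  have pls: "p = smult (lead_coeff p) (\<Prod>l\<leftarrow>ls. [:-l, 1:])"
    using S(2) unfolding ls[symmetric] by (simp flip: prod_mset_prod_list)
  have "shifted_prod B ls v = 0" for v
  proof -
    have "lead_coeff p *s shifted_prod B ls v
       = (\<Sum>i\<le>N. coeff (smult (lead_coeff p) (\<Prod>l\<leftarrow>ls. [:-l, 1:])) i *s (((*v) B) ^^ i) v)"
      unfolding shifted_prod_eq_sum[OF len] by (simp add: vec_eq_iff sum_distrib_left mult.assoc)
    also have "\<dots> = (\<Sum>i\<le>N. coeff p i *s (g i *v v))" unfolding pls[symmetric] g ..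
    also have "\<dots> = (\<Sum>i\<le>N. r i *\<^sub>R (g i *v v))"
      by (intro sum.cong refl) (simp add: coeff vec_eq_iff, simp add: scaleR_conv_of_real)
    also have "\<dots> = (\<Sum>i\<le>N. r i *\<^sub>R g i) *v v"
      by (simp add: vec_eq_iff matrix_vector_mult_def sum_distrib_right scaleR_sum_right
          sum.swap[of _ _ "{..N}"])
    also have "\<dots> = 0" by (simp add: sum0)
    finally show ?thesis using p0 by simp
  qed
  then show ?thesis by blast
qed

section \<open>Growth estimates for linear differential equations\<close>

text \<open>The integrating factor turns the equation into
  \<open>z' = exp (- l * (u - a)) * g u\<close>, whose right-hand side is dominated by the
  derivative of \<open>\<phi>\<close>; the mean value inequality then bounds \<open>z\<close>. The
  strict gap between \<open>Re l\<close> and \<open>\<mu>\<close> keeps the exponent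
  \<open>\<mu>\<close> of \<open>g\<close>, so repeated roots produce no polynomial factors.\<close>

lemma scalar_linear_ode_bound:
  fixes y g :: "real \<Rightarrow> complex"
  assumes y: "\<And>s. s \<in> {a..<b} \<Longrightarrow> (y has_vector_derivative l * y s + g s) (at s within {a..<b})"
    and g: "\<And>s. s \<in> {a..<b} \<Longrightarrow> norm (g s) \<le> K * exp (\<mu> * (s - a))"
    and l: "Re l < \<mu>" and s: "s \<in> {a..<b}" and K: "0 \<le> K"
  shows "norm (y s) \<le> (norm (y a) + K / (\<mu> - Re l)) * exp (\<mu> * (s - a))"
proof -
  define z where "z u = exp (- l * of_real (u - a)) * y u" for u
  define \<phi> where "\<phi> u = K / (\<mu> - Re l) * exp ((\<mu> - Re l) * (u - a))" for u
  have z': "(z has_vector_derivative exp (- l * of_real (u - a)) * g u) (at u within {a..<b})"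
    if "u \<in> {a..<b}" for u
    unfolding z_def
    by (rule derivative_eq_intros y[OF that] refl
      has_vector_derivative_real_field
      | simp add: algebra_simps)+
  have \<phi>': "(\<phi> has_vector_derivative K * exp ((\<mu> - Re l) * (u - a))) (at u)" for u
    using l unfolding \<phi>_def has_real_derivative_iff_has_vector_derivative[symmetric]
    by (auto intro!: derivative_eq_intros)
  have cz: "continuous_on {a..s} z"
    by (rule continuous_on_subset[OF continuous_on_vector_derivative[OF z']]) (use s in auto)
  have nz: "norm (z s - z a) \<le> \<phi> s - \<phi> a" if "a < s"
  proof (rule differentiable_bound_general[OF that cz])
    show "continuous_on {a..s} \<phi>" unfolding \<phi>_def by (intro continuous_intros)
    fix u assume u: "a < u" "u < s"
    \<comment> \<open>The mean value inequality asks for two-sided derivatives, which exist at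
      interior points.\<close>
    have "(z has_vector_derivative exp (- l * of_real (u - a)) * g u) (at u within {a<..<s})"
      using u s by (intro has_vector_derivative_within_subset[OF z']) auto
    then show "(z has_vector_derivative exp (- l * of_real (u - a)) * g u) (at u)"
      using u by (simp add: at_within_open[where S="{a<..<s}"])
    show "(\<phi> has_vector_derivative K * exp ((\<mu> - Re l) * (u - a))) (at u)" by (rule \<phi>')
    have "norm (exp (- l * of_real (u - a)) * g u) \<le> exp (- Re l * (u - a)) * (K * exp (\<mu> * (u - a)))"
      using g[of u] u s by (simp add: norm_mult mult_left_mono)
    then show "norm (exp (- l * of_real (u - a)) * g u) \<le> K * exp ((\<mu> - Re l) * (u - a))"
      by (simp add: exp_add[symmetric] algebra_simps flip: exp_add)
  qed
  have "norm (z s) \<le> norm (y a) + \<phi> s"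
  proof (cases "a < s")
    case True
    have "\<phi> a \<ge> 0" using K l by (simp add: \<phi>_def)
    moreover have "z a = y a" by (simp add: z_def)
    ultimately show ?thesis using nz[OF True] norm_triangle_sub[of "z s" "z a"] by simp
  next
    case False
    then show ?thesis using s K l by (simp add: z_def \<phi>_def)
  qed
  also have "\<dots> \<le> (norm (y a) + K / (\<mu> - Re l)) * exp ((\<mu> - Re l) * (s - a))"
  proof -
    have "norm (y a) * 1 \<le> norm (y a) * exp ((\<mu> - Re l) * (s - a))"
      using l s by (intro mult_left_mono) auto
    then show ?thesis by (simp add: \<phi>_def algebra_simps)
  qed
  finally have *: "norm (z s) \<le> (norm (y a) + K / (\<mu> - Re l)) * exp ((\<mu> - Re l) * (s - a))" .
  have "norm (y s) = exp (Re l * (s - a)) * norm (z s)"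
    by (simp add: z_def norm_mult flip: exp_add)
  also have "\<dots> \<le> exp (Re l * (s - a)) *
      ((norm (y a) + K / (\<mu> - Re l)) * exp ((\<mu> - Re l) * (s - a)))"
    by (intro mult_left_mono *) auto
  also have "\<dots> = (norm (y a) + K / (\<mu> - Re l)) * exp (\<mu> * (s - a))"
    by (simp add: algebra_simps flip: exp_add)
  finally show ?thesis .
qed

text \<open>The scalar estimate applies to each component; \<open>CARD('n)\<close> arises from
  bounding the Euclidean norm by the sum of the moduli.\<close>

lemma vector_linear_ode_bound:
  fixes y g :: "real \<Rightarrow> complex^'n"
  assumes y: "\<And>s. s \<in> {a..<b} \<Longrightarrow> (y has_vector_derivative l *s y s + g s) (at s within {a..<b})"
    and g: "\<And>s. s \<in> {a..<b} \<Longrightarrow> norm (g s) \<le> K * exp (\<mu> * (s - a))"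
    and l: "Re l < \<mu>" and s: "s \<in> {a..<b}" and K: "0 \<le> K"
  shows "norm (y s) \<le> CARD('n) * (norm (y a) + K / (\<mu> - Re l)) * exp (\<mu> * (s - a))"
proof -
  have "norm (y s $ j) \<le> (norm (y a) + K / (\<mu> - Re l)) * exp (\<mu> * (s - a))" for j
  proof -
    have "norm (y s $ j) \<le> (norm (y a $ j) + K / (\<mu> - Re l)) * exp (\<mu> * (s - a))"
    proof (rule scalar_linear_ode_bound[OF _ _ l s K])
      fix u assume u: "u \<in> {a..<b}"
      show "((\<lambda>s. y s $ j) has_vector_derivative l * y u $ j + g u $ j) (at u within {a..<b})"
        using bounded_linear.has_vector_derivative[OF bounded_linear_vec_nth[where i=j] y[OF u]]
        by simp
      show "norm (g u $ j) \<le> K * exp (\<mu> * (u - a))"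
        using Finite_Cartesian_Product.norm_nth_le[of "g u" j] g[OF u] by linarith
    qed
    also have "\<dots> \<le> (norm (y a) + K / (\<mu> - Re l)) * exp (\<mu> * (s - a))"
      using Finite_Cartesian_Product.norm_nth_le[of "y a" j] by (intro mult_right_mono) auto
    finally show ?thesis .
  qed
  then have "(\<Sum>j\<in>UNIV. norm (y s $ j)) \<le>
      (\<Sum>j\<in>(UNIV::'n set). (norm (y a) + K / (\<mu> - Re l)) * exp (\<mu> * (s - a)))"
    by (intro sum_mono)
  moreover have "norm (y s) \<le> (\<Sum>j\<in>UNIV. norm (y s $ j))"
    unfolding norm_vec_def by (rule L2_set_le_sum) simp
  ultimately show ?thesis by (simp add: mult.assoc)
qed

text \<open>The constant depends on \<open>B\<close>, \<open>ls\<close> and \<open>\<mu>\<close>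
  only, neither on the solution nor on the interval. This uniformity makes it usable on all
  switching intervals at once.\<close>

lemma shifted_prod_ode_bound:
  fixes B :: "complex^'n^'n"
  assumes "\<And>l. l \<in> set ls \<Longrightarrow> Re l < \<mu>"
  obtains C where "0 \<le> C"
    "\<And>y a b s. \<lbrakk>\<And>u. u \<in> {a..<b} \<Longrightarrow> (y has_vector_derivative B *v y u) (at u within {a..<b});
       \<And>u. u \<in> {a..<b} \<Longrightarrow> shifted_prod B ls (y u) = 0; s \<in> {a..<b}\<rbrakk>
       \<Longrightarrow> norm (y s) \<le> C * norm (y a) * exp (\<mu> * (s - a))"
  using assms
proof (induction ls arbitrary: thesis)
  case Nil
  \<comment> \<open>The empty product is the identity, so \<open>y\<close> vanishes on the
    interval.\<close>
  show ?case by (rule Nil(1)[of 0]) auto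
next
  case (Cons l ls)
  obtain C where C: "0 \<le> C"
    "\<And>y a b s. \<lbrakk>\<And>u. u \<in> {a..<b} \<Longrightarrow> (y has_vector_derivative B *v y u) (at u within {a..<b});
       \<And>u. u \<in> {a..<b} \<Longrightarrow> shifted_prod B ls (y u) = 0; s \<in> {a..<b}\<rbrakk>
       \<Longrightarrow> norm (y s) \<le> C * norm (y a) * exp (\<mu> * (s - a))"
    using Cons.IH Cons.prems(2) by (metis list.set_intros(2))
  have l: "Re l < \<mu>" using Cons.prems(2) by simp
  have lin: "bounded_linear (\<lambda>v. B *v v - l *s v)"
    unfolding linear_conv_bounded_linear[symmetric]
    by (rule linearI)
      (simp_all add: vec_eq_iff matrix_vector_right_distrib algebra_simps
        matrix_vector_mult_def sum.distrib sum_distrib_left scaleR_sum_right)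
  then obtain L where L: "0 \<le> L" "\<And>v. norm (B *v v - l *s v) \<le> norm v * L"
    using bounded_linear.nonneg_bounded by blast
  show ?case
  proof (rule Cons.prems(1))
    \<comment> \<open>\<open>C * L\<close> bounds \<open>g\<close> through its initial value
      \<open>g a\<close>; the division by the gap and the factor \<open>CARD('n)\<close> come from
      variation of constants.\<close>
    show "0 \<le> CARD('n) * (1 + C * L / (\<mu> - Re l))" using C(1) L(1) l by simp
    fix y a b s
    assume y: "\<And>u. u \<in> {a..<b} \<Longrightarrow> (y has_vector_derivative B *v y u) (at u within {a..<b})"
      and z: "\<And>u. u \<in> {a..<b} \<Longrightarrow> shifted_prod B (l # ls) (y u) = 0" and s: "s \<in> {a..<b}"
    define g where "g u = B *v y u - l *s y u" for u
    have bg: "norm (g u) \<le> (C * L * norm (y a)) * exp (\<mu> * (u - a))" if "u \<in> {a..<b}" for u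
    proof -
      have "norm (g u) \<le> C * norm (g a) * exp (\<mu> * (u - a))"
      proof (rule C(2)[OF _ _ that])
        fix u assume u: "u \<in> {a..<b}"
        have "B *v g u = B *v (B *v y u) - l *s (B *v y u)"
          by (simp add: g_def matrix_vector_mult_diff_distrib vector_scalar_commute)
        then show "(g has_vector_derivative B *v g u) (at u within {a..<b})"
          using bounded_linear.has_vector_derivative[OF lin y[OF u]] unfolding g_def[abs_def] by simp
        show "shifted_prod B ls (g u) = 0" using z[OF u] by (simp add: g_def)
      qed
      also have "\<dots> \<le> C * (norm (y a) * L) * exp (\<mu> * (u - a))"
        using L(2) C(1) unfolding g_def by (intro mult_right_mono mult_left_mono) auto
      finally show ?thesis by (simp add: mult_ac)
    qed
    have "norm (y s) \<le> CARD('n) * (norm (y a) + C * L * norm (y a) / (\<mu> - Re l)) * exp (\<mu> * (s - a))"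
      using y C(1) L(1) by (intro vector_linear_ode_bound[OF _ bg l s]) (auto simp: g_def)
    then show "norm (y s) \<le> CARD('n) * (1 + C * L / (\<mu> - Re l)) * norm (y a) * exp (\<mu> * (s - a))"
      by (simp add: algebra_simps)
  qed
qed

section \<open>Growth bounds for real linear flows\<close>

definition complex_vector :: "real^'n \<Rightarrow> complex^'n" where
  "complex_vector v = (\<chi> i. complex_of_real (v $ i))"

lemma norm_complex_vector [simp]: "norm (complex_vector v) = norm v"
  by (simp add: complex_vector_def norm_vec_def)

lemma complex_vector_has_vector_derivative:
  assumes "(x has_vector_derivative x') F"
  shows "((\<lambda>s. complex_vector (x s)) has_vector_derivative complex_vector x') F"
proof -
  have "linear (complex_vector :: real^'n \<Rightarrow> _)"
    by (rule linearI) (simp_all add: complex_vector_def vec_eq_iff, simp add: scaleR_conv_of_real)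
  then show ?thesis
    using bounded_linear.has_vector_derivative[OF _ assms] linear_conv_bounded_linear by blast
qed

lemma complex_vector_matrix_mult: "complex_vector (A *v v) = complexify A *v complex_vector v"
  by (simp add: vec_eq_iff complex_vector_def complexify_def matrix_vector_mult_def)

text \<open>An exponential bound on the flow, phrased through solutions on half-open intervals as
  they occur in \<open>impulsive_solution\<close>.\<close>

definition flow_growth_bound :: "real^'n^'n \<Rightarrow> real \<Rightarrow> real \<Rightarrow> bool" where
  "flow_growth_bound A \<mu> C \<longleftrightarrow> (\<forall>x a b. \<forall>s\<in>{a..<b}.
     (\<forall>u\<in>{a..<b}. (x has_vector_derivative A *v x u) (at u within {a..<b})) \<longrightarrow>
     norm (x s) \<le> C * norm (x a) * exp (\<mu> * (s - a)))"

text \<open>Complexification preserves norms and maps real solutions to solutions of the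
  complexified equation, so the complex estimate descends.\<close>

lemma flow_growth_bound_if_annihilating:
  assumes "\<And>v. shifted_prod (complexify A) ls v = 0" and "\<And>l. l \<in> set ls \<Longrightarrow> Re l < \<mu>"
  obtains C where "flow_growth_bound A \<mu> C"
proof -
  obtain C where C: "\<And>y a b s.
      \<lbrakk>\<And>u. u \<in> {a..<b} \<Longrightarrow> (y has_vector_derivative complexify A *v y u) (at u within {a..<b});
       \<And>u. u \<in> {a..<b} \<Longrightarrow> shifted_prod (complexify A) ls (y u) = 0; s \<in> {a..<b}\<rbrakk>
       \<Longrightarrow> norm (y s) \<le> C * norm (y a) * exp (\<mu> * (s - a))"
    using shifted_prod_ode_bound[of ls \<mu> "complexify A"] assms(2) by metis
  have "flow_growth_bound A \<mu> C"
    unfolding flow_growth_bound_def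
  proof (intro allI ballI impI)
    fix x a b s
    assume s: "s \<in> {a..<b}"
      and x: "\<forall>u\<in>{a..<b}. (x has_vector_derivative A *v x u) (at u within {a..<b})"
    show "norm (x s) \<le> C * norm (x a) * exp (\<mu> * (s - a))"
      using C[of a b "\<lambda>s. complex_vector (x s)" s] x s assms(1)
      by (simp add: complex_vector_has_vector_derivative flip: complex_vector_matrix_mult)
  qed
  then show ?thesis using that by blast
qed

text \<open>Once the factors that do not belong to eigenvalues are discarded, all remaining roots
  have real part strictly below 0, so the exponent 0 is admissible.\<close>

lemma flow_growth_bound_stable:
  assumes "stable_matrix A"
  obtains C where "flow_growth_bound A 0 C"
proof -
  let ?B = "complexify A"
  obtain ls where ls: "\<And>v. shifted_prod ?B ls v = 0"
    using annihilating_shifted_prod by blast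
  show ?thesis
  proof (rule flow_growth_bound_if_annihilating[OF shifted_prod_filter[OF ls] _ that])
    show "Re l < 0" if "l \<in> set (filter (\<lambda>l. \<exists>v. v \<noteq> 0 \<and> ?B *v v = l *s v) ls)" for l
      using that assms unfolding stable_matrix_def complex_eigenvalue_def by auto
  qed
qed

text \<open>Any exponent above the real parts of all roots works. Its nonnegativity allows
  \<open>s - a\<close> to be replaced by an upper bound such as \<open>\<eta>\<close>.\<close>

lemma flow_growth_bound_exists:
  obtains \<mu> C where "0 \<le> \<mu>" "flow_growth_bound A \<mu> C"
proof -
  obtain ls where ls: "\<And>v. shifted_prod (complexify A) ls v = 0"
    using annihilating_shifted_prod by blast
  define \<mu> where "\<mu> = 1 + (\<Sum>l\<in>set ls. \<bar>Re l\<bar>)"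
  have "Re l < \<mu>" if "l \<in> set ls" for l
    using member_le_sum[OF that, of "\<lambda>l. \<bar>Re l\<bar>"] by (simp add: \<mu>_def)
  then obtain C where "flow_growth_bound A \<mu> C" using flow_growth_bound_if_annihilating[OF ls] by metis
  moreover have "0 \<le> \<mu>" by (simp add: \<mu>_def sum_nonneg add_nonneg_nonneg)
  ultimately show ?thesis using that by blast
qed

lemma uniform_growth_bound:
  fixes A :: "'p \<Rightarrow> real^'n^'n"
  assumes "finite P"
  obtains M where "1 \<le> M"
    "\<And>p x a b s. \<lbrakk>p \<in> P; stable_matrix (A p) \<or> b - a \<le> \<eta>; s \<in> {a..<b};
       \<And>u. u \<in> {a..<b} \<Longrightarrow> (x has_vector_derivative A p *v x u) (at u within {a..<b})\<rbrakk>
       \<Longrightarrow> norm (x s) \<le> M * norm (x a)"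
proof -
  have "\<exists>C. \<forall>x a b. \<forall>s\<in>{a..<b}. (stable_matrix (A p) \<or> b - a \<le> \<eta>) \<longrightarrow>
      (\<forall>u\<in>{a..<b}. (x has_vector_derivative A p *v x u) (at u within {a..<b})) \<longrightarrow>
      norm (x s) \<le> C * norm (x a)" for p
  proof (cases "stable_matrix (A p)")
    case True
    then obtain C where "flow_growth_bound (A p) 0 C" using flow_growth_bound_stable by blast
    then show ?thesis unfolding flow_growth_bound_def by (intro exI[of _ C]) fastforce
  next
    case False
    obtain \<mu> C where \<mu>: "0 \<le> \<mu>" and C: "flow_growth_bound (A p) \<mu> C" using flow_growth_bound_exists .
    \<comment> \<open>The absolute value is taken because \<open>flow_growth_bound\<close> does not
      fix the sign of \<open>C\<close>.\<close>
    have "norm (x s) \<le> (\<bar>C\<bar> * exp (\<mu> * \<eta>)) * norm (x a)"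
      if s: "s \<in> {a..<b}" "b - a \<le> \<eta>"
        and x: "\<forall>u\<in>{a..<b}. (x has_vector_derivative A p *v x u) (at u within {a..<b})"
      for x :: "real \<Rightarrow> real^'n" and a b s
    proof -
      have "norm (x s) \<le> C * norm (x a) * exp (\<mu> * (s - a))"
        using C s x unfolding flow_growth_bound_def by blast
      also have "\<dots> \<le> \<bar>C\<bar> * norm (x a) * exp (\<mu> * \<eta>)"
        using s \<mu> by (intro mult_mono) (auto intro!: mult_right_mono mult_left_mono)
      finally show ?thesis by (simp add: mult_ac)
    qed
    with False show ?thesis by blast
  qed
  then obtain C where C: "\<And>p x a b s. s \<in> {a..<b} \<Longrightarrow> stable_matrix (A p) \<or> b - a \<le> \<eta> \<Longrightarrow>
      \<forall>u\<in>{a..<b}. (x has_vector_derivative A p *v x u) (at u within {a..<b}) \<Longrightarrow>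
      norm (x s) \<le> C p * norm (x a)"
    by metis
  show ?thesis
  proof (rule that)
    \<comment> \<open>The sum over the finite set \<open>P\<close> dominates every
      \<open>C p\<close>; the summand 1 keeps the bound positive, so that its reciprocal can serve
      as an impulse factor.\<close>
    show "1 \<le> 1 + (\<Sum>p\<in>P. \<bar>C p\<bar>)" by (simp add: sum_nonneg)
    fix p x a b s
    assume p: "p \<in> P" and *: "stable_matrix (A p) \<or> b - a \<le> \<eta>" "s \<in> {a..<b}"
      "\<And>u. u \<in> {a..<b} \<Longrightarrow> (x has_vector_derivative A p *v x u) (at u within {a..<b})"
    have "C p \<le> 1 + (\<Sum>p\<in>P. \<bar>C p\<bar>)"
      using member_le_sum[OF p, of "\<lambda>p. \<bar>C p\<bar>"] assms by simp
    then show "norm (x s) \<le> (1 + (\<Sum>p\<in>P. \<bar>C p\<bar>)) * norm (x a)"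
      using C[of s a b p x] * by (meson mult_right_mono norm_ge_zero order_trans)
  qed
qed

section \<open>Switching signals between their switching times\<close>

text \<open>The signal is locally constant on a connected interval: at the left endpoint by right
  continuity, elsewhere because no discontinuity lies inside.\<close>

lemma signal_constant_between_switches:
  assumes rc: "right_continuous_signal \<sigma>" and t: "switching_times \<sigma> t"
    and s: "s \<in> {t k..<t (Suc k)}"
  shows "\<sigma> s = \<sigma> (t k)"
proof (rule connected_local_const[of "{t k..<t (Suc k)}"])
  have mono: "strict_mono t" and t0: "t 0 = 0" and disc: "discontinuities \<sigma> = t ` {1..}"
    using t unfolding switching_times_def by auto
  have tk: "0 \<le> t k" using mono t0 by (metis le0 strict_mono_less_eq)
  show "\<forall>a\<in>{t k..<t (Suc k)}. \<forall>\<^sub>F b in at a within {t k..<t (Suc k)}. \<sigma> a = \<sigma> b"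
  proof
    fix a assume a: "a \<in> {t k..<t (Suc k)}"
    show "\<forall>\<^sub>F b in at a within {t k..<t (Suc k)}. \<sigma> a = \<sigma> b"
    proof (cases "a = t k")
      case True
      have "\<forall>\<^sub>F b in at_right a. \<sigma> b = \<sigma> a"
        using rc a tk unfolding right_continuous_signal_def by auto
      then have "\<forall>\<^sub>F b in at a within {t k..<t (Suc k)}. \<sigma> b = \<sigma> a"
        unfolding eventually_at_filter True by eventually_elim auto
      then show ?thesis by eventually_elim simp
    next
      case False
      have "a \<notin> t ` {1..}"
      proof
        assume "a \<in> t ` {1..}"
        then obtain j where j: "a = t j" by auto
        have "k \<le> j" "j < Suc k"
          using a strict_mono_less_eq[OF mono] strict_mono_less[OF mono] unfolding j by auto
        then show False using False j by (simp add: less_Suc_eq)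
      qed
      then have "\<forall>\<^sub>F b in at a within {0..}. \<sigma> b = \<sigma> a"
        using a tk unfolding disc[symmetric] discontinuities_def by auto
      then have "\<forall>\<^sub>F b in at a within {t k..<t (Suc k)}. \<sigma> b = \<sigma> a"
        by (rule filter_leD[rotated]) (use tk in \<open>auto intro!: at_le\<close>)
      then show ?thesis by eventually_elim simp
    qed
  qed
qed (use s in auto)

text \<open>As the switching times tend to infinity, there is a first one beyond \<open>s\<close>;
  it has a predecessor because \<open>t 0 = 0\<close>.\<close>

lemma switching_interval:
  assumes "switching_times \<sigma> t" "0 \<le> s"
  obtains k where "s \<in> {t k..<t (Suc k)}"
proof -
  have "\<exists>n. s < t n"
    using assms(1) unfolding switching_times_def filterlim_at_top_dense
    by (metis eventually_False_sequentially eventually_mono)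
  define n where "n = (LEAST n. s < t n)"
  have n: "s < t n" unfolding n_def using \<open>\<exists>n. s < t n\<close> by (rule LeastI_ex)
  have "t 0 = 0" using assms(1) by (simp add: switching_times_def)
  then obtain k where k: "n = Suc k" using n assms(2) by (cases n) auto
  have "\<not> s < t k" using not_less_Least[of k "\<lambda>n. s < t n"] k unfolding n_def by simp
  then show ?thesis using n k that[of k] by simp
qed

section \<open>Stability under a single contracting impulse\<close>

theorem theorem3p5:
  fixes P :: "'p set" and A :: "'p \<Rightarrow> real^'n^'n"
    and \<tau> \<eta> :: real and \<sigma> :: "real \<Rightarrow> 'p" and t :: "nat \<Rightarrow> real"
  assumes "finite P"
    and "\<forall>p\<in>P. stable_matrix (A p) \<or> unstable_matrix (A p)"
    and "\<tau> > 0" and "\<eta> > 0"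
    and "\<sigma> \<in> dwell_flee_signals P A \<tau> \<eta>"
    and "switching_times \<sigma> t"
  shows "\<exists>(Q :: (real^'n^'n) set) (I :: real^'n^'n \<Rightarrow> real^'n^'n).
           Q \<noteq> {} \<and> (\<forall>q\<in>Q. I q \<noteq> 0) \<and>
           (\<forall>\<omega> \<in> t ` {1..} \<rightarrow> Q. impulsive_stable A \<sigma> t I \<omega>)"
proof -
  obtain M where M: "1 \<le> M"
    and growth: "\<And>p x a b s. \<lbrakk>p \<in> P; stable_matrix (A p) \<or> b - a \<le> \<eta>; s \<in> {a..<b};
       \<And>u. u \<in> {a..<b} \<Longrightarrow> (x has_vector_derivative A p *v x u) (at u within {a..<b})\<rbrakk>
       \<Longrightarrow> norm (x s) \<le> M * norm (x a)"
    using uniform_growth_bound[OF assms(1)] by metis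
  define J :: "real^'n^'n" where "J = mat (1 / M)"
  have J: "J *v v = (1 / M) *\<^sub>R v" for v
    by (simp add: J_def vec_eq_iff matrix_vector_mult_def mat_def if_distrib[of "\<lambda>c. c * _"]
        cong: if_cong)
  have "J \<noteq> 0" using M by (simp add: J_def vec_eq_iff mat_def)
  have t0: "t 0 = 0" and mono: "strict_mono t"
    using assms(6) unfolding switching_times_def by auto
  have tk: "0 \<le> t k" for k using mono t0 by (metis le0 strict_mono_less_eq)
  have sig: "switching_signal P \<sigma>"
    and flee: "unstable_matrix (A (\<sigma> (t k))) \<Longrightarrow> t (Suc k) - t k \<le> \<eta>" for k
    using assms(5,6) unfolding dwell_flee_signals_def by force+
  have rc: "right_continuous_signal \<sigma>" and P: "\<sigma> (t k) \<in> P" for k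
    using sig tk unfolding switching_signal_def by auto
  have bound: "norm (x s) \<le> M * norm (x 0)"
    if \<omega>: "\<omega> \<in> t ` {1..} \<rightarrow> {J}" and sol: "impulsive_solution A \<sigma> t (\<lambda>q. q) \<omega> x" and "0 \<le> s"
    for \<omega> x s
  proof -
    have step: "norm (x u) \<le> M * norm (x (t k))" if "u \<in> {t k..<t (Suc k)}" for k u
    proof (rule growth[OF P _ that])
      \<comment> \<open>A matrix of the family that is not stable is unstable, and then
        \<open>flee\<close> limits the length of the interval.\<close>
      show "stable_matrix (A (\<sigma> (t k))) \<or> t (Suc k) - t k \<le> \<eta>"
        using assms(2) P[of k] flee by blast
      fix v assume v: "v \<in> {t k..<t (Suc k)}"
      then have "(x has_vector_derivative A (\<sigma> v) *v x v) (at v within {t k..<t (Suc k)})"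
        using sol unfolding impulsive_solution_def by (metis One_nat_def diff_Suc_1 le_add1 plus_1_eq_Suc)
      then show "(x has_vector_derivative A (\<sigma> (t k)) *v x v) (at v within {t k..<t (Suc k)})"
        unfolding signal_constant_between_switches[OF rc assms(6) v] .
    qed
    have jump: "norm (x (t k)) \<le> norm (x 0)" for k
    proof (induction k)
      case (Suc k)
      obtain y where y: "(x \<longlongrightarrow> y) (at_left (t (Suc k)))" "x (t (Suc k)) = \<omega> (t (Suc k)) *v y"
        using sol unfolding impulsive_solution_def by (metis le_add1 plus_1_eq_Suc)
      have "t k < t (Suc k)" using mono by (simp add: strict_mono_less)
      \<comment> \<open>The estimate holds up to, but not at, the switching time. It passes to the
        left limit \<open>y\<close>, and the impulse \<open>1 / M\<close> then cancels the factor
        \<open>M\<close>.\<close>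
      then have "\<forall>\<^sub>F u in at_left (t (Suc k)). norm (x u) \<le> M * norm (x (t k))"
        using step eventually_at_left_field by (fastforce simp: eventually_at_left_field)
      then have "norm y \<le> M * norm (x (t k))"
        by (rule tendsto_upperbound[OF tendsto_norm[OF y(1)]]) simp
      moreover have "\<omega> (t (Suc k)) = J" using \<omega> by auto
      ultimately have "norm (x (t (Suc k))) \<le> norm (x (t k))"
        using M by (simp add: y(2) J field_simps)
      with Suc show ?case by simp
    qed (simp add: t0)
    obtain k where "s \<in> {t k..<t (Suc k)}" using switching_interval[OF assms(6) \<open>0 \<le> s\<close>] .
    from step[OF this] show ?thesis
      using jump[of k] M by (meson mult_left_mono order_trans zero_le_one)
  qed
  have "impulsive_stable A \<sigma> t (\<lambda>q. q) \<omega>" if \<omega>: "\<omega> \<in> t ` {1..} \<rightarrow> {J}" for \<omega>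
    unfolding impulsive_stable_def
  proof (intro allI impI)
    fix \<epsilon> :: real assume "\<epsilon> > 0"
    \<comment> \<open>\<open>bound\<close> controls all times by \<open>M\<close> times the initial
      norm, hence the choice \<open>\<delta> = \<epsilon> / M\<close>.\<close>
    then have "norm (x s) < \<epsilon>"
      if "impulsive_solution A \<sigma> t (\<lambda>q. q) \<omega> x" "norm (x 0) < \<epsilon> / M" "s > 0" for x s
      using bound[OF \<omega> that(1), of s] that M by (simp add: field_simps)
    then show "\<exists>\<delta>>0. \<forall>x. impulsive_solution A \<sigma> t (\<lambda>q. q) \<omega> x \<longrightarrow> norm (x 0) < \<delta> \<longrightarrow>
        (\<forall>s>0. norm (x s) < \<epsilon>)"
      using \<open>\<epsilon> > 0\<close> M by (intro exI[of _ "\<epsilon> / M"]) auto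
  qed
  with \<open>J \<noteq> 0\<close> show ?thesis
    by (intro exI[of _ "{J}"] exI[of _ "\<lambda>q. q"]) auto
qed

end
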